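(* Let $d\ge1$, let $\lambda=(\lambda_{J,\tau})$ be a complete signed tail family, and let $w$ be the coefficient system recovered from $\lambda$ by triangular inversion. Assume that $w_{I,\sigma}\ge 0$ for all $(I,\sigma)\in\mathcal G_d$ and that $\lambda_{\{i\},\mathrm L}=\lambda_{\{i\},\mathrm U}=1$ for $i=1,\dots,d$; set $S(w)=\sum_{(I,\sigma)\in\mathcal G_d}w_{I,\sigma}$. Let $(p_n)_{n\ge1}$ be any sequence of positive reals with $p_n\downarrow0$. Then, for all sufficiently large $n$, there exists a geometric witness copula $C_{p_n}$ (at scale $p_n$) such that the complete finite-threshold signed tail family induced by $C_{p_n}$ at scale $p_n$ is exactly $\lambda$, i.e. $\lambda^{(p_n)}(C_{p_n})=\lambda$. Moreover, for every such realization, $$q^{(p_n)}_{\mathrm M^d}=1-p_nS(w)\longrightarrow 1,$$ where $q^{(p_n)}_{\mathrm M^d}$ is the mass that $C_{p_n}$ assigns to the central cell $[p_n,1-p_n]^d$.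
   Context: Notation. $[d]=\{1,\dots,d\}$; $\mathcal G_d=\{(I,\sigma):\emptyset\ne I\subseteq[d],\ \sigma\in\{\mathrm L,\mathrm U\}^I\}$, where $\{\mathrm L,\mathrm U\}^I$ is the set of functions $I\to\{\mathrm L,\mathrm U\}$. A complete signed tail family is a real family $\lambda=(\lambda_{J,\tau})$ indexed by all $(J,\tau)\in\mathcal G_d$. Triangular inversion. The coefficient system $w=(w_{I,\sigma})_{(I,\sigma)\in\mathcal G_d}$ recovered from $\lambda$ is defined recursively, by descending $|I|$ from $d$ to $1$, by $w_{I,\sigma}=\lambda_{I,\sigma}-\sum_{K\supsetneq I}\sum_{\rho\in\{\mathrm L,\mathrm U\}^K:\,\rho|_I=\sigma}w_{K,\rho}$. Finite-threshold family of a copula. For $p\in(0,1/2)$ let $L_p=[0,p]$, $M_p=[p,1-p]$, $U_p=[1-p,1]$. For a copula $C$ and $U\sim C$, and $a\in\{\mathrm L,\mathrm M,\mathrm U\}^d$, let $q_a^{(p)}=\Pr(U\in B_a^{(p)})$, where $B_a^{(p)}$ is the product of the intervals $L_p$, $M_p$, $U_p$ chosen in coordinate $i$ according to $a_i=\mathrm L,\mathrm M,\mathrm U$ (a partition modulo null sets). For $(J,\tau)\in\mathcal G_d$, $\lambda^{(p)}_{J,\tau}(C)=\frac1p\sum_{a:\,a|_J=\tau}q_a^{(p)}$, and $\lambda^{(p)}(C)=(\lambda^{(p)}_{J,\tau}(C))$. Geometric witness copula at scale $p_0\in(0,1/2)$. For $(I,\sigma)\in\mathcal G_d$ let $\mu_{I,\sigma}^{(p_0)}$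 be the law of $(U_1,\dots,U_d)$ with $U_i=p_0Z$ if $i\in I,\sigma_i=\mathrm L$; $U_i=1-p_0Z$ if $i\in I,\sigma_i=\mathrm U$; $U_i=p_0+(1-2p_0)V_i$ if $i\notin I$, where $Z$ and the $V_i$ are independent and uniform on $[0,1]$. Let $\mu_0^{(p_0)}$ be the law of $(p_0+(1-2p_0)V_i)_{i=1}^d$ with $V_i$ i.i.d. uniform on $[0,1]$. For a nonnegative weight system $v=(v_{I,\sigma})_{(I,\sigma)\in\mathcal G_d}$ with $m_0=1-p_0\sum v_{I,\sigma}\ge0$, put $\mu^{(v,p_0)}=m_0\mu_0^{(p_0)}+\sum_{(I,\sigma)\in\mathcal G_d}p_0v_{I,\sigma}\,\mu_{I,\sigma}^{(p_0)}$. If $\mu^{(v,p_0)}$ has uniform one-dimensional margins, its distribution function $C^{(v,p_0)}$ is called a geometric witness copula at scale $p_0$. *)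

theory Defs
  imports "HOL-Probability.Probability"
begin

text \<open>
  Points of \<open>\<real>\<^sup>d\<close> are extensional functions on \<open>{1..d}\<close>, so that measures on \<open>\<real>\<^sup>d\<close> live on
  the library product \<open>Pi\<^sub>M {1..d} (\<lambda>_. borel)\<close>.  A sign vector on \<open>I\<close> is likewise an
  extensional function into \<open>{Lower, Upper}\<close>, hence restriction of sign vectors and of cell
  labels is \<^const>\<open>restrict\<close>.
\<close>

datatype label = Lower | Middle | Upper

definition signs :: "nat set \<Rightarrow> (nat \<Rightarrow> label) set" where
  "signs I = (I \<rightarrow>\<^sub>E {Lower, Upper})"

definition signed_faces :: "nat \<Rightarrow> (nat set \<times> (nat \<Rightarrow> label)) set" where
  "signed_faces d = {(I, \<sigma>). I \<noteq> {} \<and> I \<subseteq> {1..d} \<and> \<sigma> \<in> signs I}"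

text \<open>
  A family indexed by \<^term>\<open>signed_faces d\<close> is a total function; its values at other arguments
  are never used.
\<close>

type_synonym signed_family = "nat set \<Rightarrow> (nat \<Rightarrow> label) \<Rightarrow> real"

function tri_inv :: "nat \<Rightarrow> signed_family \<Rightarrow> signed_family" where
  "tri_inv d lam I \<sigma> = lam I \<sigma> -
     (\<Sum>K | I \<subset> K \<and> K \<subseteq> {1..d}. \<Sum>\<rho> | \<rho> \<in> signs K \<and> restrict \<rho> I = \<sigma>. tri_inv d lam K \<rho>)"
  by pat_completeness auto
termination
proof (relation "Wellfounded.measure (\<lambda>(d, lam, I, \<sigma>). card ({1..d} - I))", goal_cases)
  case (2 d lam I \<sigma> K \<rho>)
  then have "{1..d} - K \<subset> {1..d} - I" by blast
  then show ?case by (simp add: psubset_card_mono)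
qed simp

declare tri_inv.simps [simp del]

definition total_weight :: "nat \<Rightarrow> signed_family \<Rightarrow> real" where
  "total_weight d w = (\<Sum>(I, \<sigma>)\<in>signed_faces d. w I \<sigma>)"

definition distribution_function :: "nat \<Rightarrow> (nat \<Rightarrow> real) measure \<Rightarrow> (nat \<Rightarrow> real) \<Rightarrow> real" where
  "distribution_function d \<mu> u = measure \<mu> (\<Pi>\<^sub>E i\<in>{1..d}. {..u i})"

text \<open>
  The law of a random vector \<open>U \<sim> C\<close>, that is, the Borel probability measure on \<open>\<real>\<^sup>d\<close> with
  distribution function \<open>C\<close>.
\<close>

definition law_of :: "nat \<Rightarrow> ((nat \<Rightarrow> real) \<Rightarrow> real) \<Rightarrow> (nat \<Rightarrow> real) measure" where
  "law_of d C = (THE \<mu>. prob_space \<mu> \<and> sets \<mu> = sets (Pi\<^sub>M {1..d} (\<lambda>_. borel)) \<and>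
     distribution_function d \<mu> = C)"

text \<open>The following two lemmas show that the description above is a proper one.\<close>

lemma law_unique:
  assumes "prob_space \<mu>" "sets \<mu> = sets (Pi\<^sub>M {1..d} (\<lambda>_. borel))"
    and "prob_space \<nu>" "sets \<nu> = sets (Pi\<^sub>M {1..d} (\<lambda>_. borel))"
    and eq: "distribution_function d \<mu> = distribution_function d \<nu>"
  shows "\<mu> = \<nu>"
proof -
  interpret m: prob_space \<mu> by fact
  interpret n: prob_space \<nu> by fact
  let ?E = "range (\<lambda>a::real. {..a})"
  let ?P = "{\<Pi>\<^sub>E i\<in>{1..d}. X i | X. \<forall>i\<in>{1..d}. X i \<in> ?E}"
  let ?S = "\<Pi>\<^sub>E i\<in>{1..d}. (UNIV::real set)"
  let ?A = "\<lambda>k::nat. \<Pi>\<^sub>E i\<in>{1..d}. {..real k}"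
  have gen: "sets (Pi\<^sub>M {1..d} (\<lambda>_. borel :: real measure)) = sigma_sets ?S ?P"
  proof -
    have "sets (Pi\<^sub>M {1..d} (\<lambda>_. borel :: real measure)) =
        sets (Pi\<^sub>M {1..d} (\<lambda>_. sigma UNIV ?E))"
      by (simp add: borel_eq_atMost)
    also have "\<dots> = sets (sigma ?S {{f\<in>?S. \<forall>i\<in>j. f i \<in> X i} | X j.
        j \<in> {{1..d}} \<and> X \<in> Pi j (\<lambda>_. ?E)})"
    proof (rule sets_PiM_sigma)
      show "\<exists>S\<subseteq>?E. countable S \<and> (UNIV::real set) = \<Union>S"
      proof (intro exI conjI)
        show "range (\<lambda>k::nat. {..real k}) \<subseteq> ?E" by auto
        show "(UNIV::real set) = \<Union> (range (\<lambda>k::nat. {..real k}))"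
          using real_arch_simple by auto
      qed auto
    qed auto
    also have "{{f\<in>?S. \<forall>i\<in>j. f i \<in> X i} | X j. j \<in> {{1..d}} \<and> X \<in> Pi j (\<lambda>_. ?E)} = ?P"
    proof -
      have "{f\<in>?S. \<forall>i\<in>{1..d}. f i \<in> X i} = Pi\<^sub>E {1..d} X" for X
        by (auto simp: PiE_iff extensional_def)
      then show ?thesis by (auto simp: Pi_iff)
    qed
    also have "sets (sigma ?S ?P) = sigma_sets ?S ?P"
      by (rule sets_measure_of) auto
    finally show ?thesis .
  qed
  show ?thesis
  proof (rule measure_eqI_generator_eq[where E = ?P and \<Omega> = ?S and A = ?A])
    show "Int_stable ?P"
    proof (rule Int_stableI)
      fix a b assume "a \<in> ?P" "b \<in> ?P"
      then obtain X Y where X: "a = Pi\<^sub>E {1..d} X" "\<forall>i\<in>{1..d}. X i \<in> ?E"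
        and Y: "b = Pi\<^sub>E {1..d} Y" "\<forall>i\<in>{1..d}. Y i \<in> ?E" by blast
      have "a \<inter> b = (\<Pi>\<^sub>E i\<in>{1..d}. X i \<inter> Y i)"
        using X Y by (simp add: PiE_Int)
      moreover have "\<forall>i\<in>{1..d}. X i \<inter> Y i \<in> ?E"
      proof
        fix i assume "i \<in> {1..d}"
        then obtain s t where "X i = {..s}" "Y i = {..t}" using X Y by blast
        then have "X i \<inter> Y i = {..min s t}" by auto
        then show "X i \<inter> Y i \<in> ?E" by blast
      qed
      ultimately show "a \<inter> b \<in> ?P" by blast
    qed
    show "?P \<subseteq> Pow ?S" by auto
    show "emeasure \<mu> X = emeasure \<nu> X" if "X \<in> ?P" for X
    proof -
      from that obtain Y where Y: "X = Pi\<^sub>E {1..d} Y" "\<forall>i\<in>{1..d}. Y i \<in> ?E" by blast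
      then have "\<forall>i\<in>{1..d}. \<exists>t. Y i = {..t}" by blast
      then obtain u where "\<forall>i\<in>{1..d}. Y i = {..u i}" by metis
      then have "X = (\<Pi>\<^sub>E i\<in>{1..d}. {..u i})" unfolding Y(1) by (intro PiE_cong) auto
      then show ?thesis
        using fun_cong[OF eq, of u]
        by (simp add: distribution_function_def m.emeasure_eq_measure n.emeasure_eq_measure)
    qed
    show "sets \<mu> = sigma_sets ?S ?P" "sets \<nu> = sigma_sets ?S ?P"
      using assms gen by simp_all
    show "range ?A \<subseteq> ?P" by blast
    show "(\<Union>k. ?A k) = ?S"
    proof (intro equalityI subsetI)
      fix x assume x: "x \<in> ?S"
      obtain k :: nat where k: "(\<Sum>i\<in>{1..d}. \<bar>x i\<bar>) \<le> real k"
        using real_arch_simple by blast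
      have "x i \<le> real k" if "i \<in> {1..d}" for i
        using member_le_sum[of i "{1..d}" "\<lambda>i. \<bar>x i\<bar>"] that k by simp
      then have "x \<in> ?A k" using x by (auto simp: PiE_iff)
      then show "x \<in> (\<Union>k. ?A k)" by blast
    qed auto
    show "emeasure \<mu> (?A k) \<noteq> \<infinity>" for k by simp
  qed
qed

lemma law_of_distribution_function:
  assumes "prob_space \<mu>" "sets \<mu> = sets (Pi\<^sub>M {1..d} (\<lambda>_. borel))"
  shows "law_of d (distribution_function d \<mu>) = \<mu>"
  unfolding law_of_def by (rule the_equality) (use assms law_unique in blast)+

fun cell_side :: "real \<Rightarrow> label \<Rightarrow> real set" where
  "cell_side p Lower = {0..p}"
| "cell_side p Middle = {p..1 - p}"
| "cell_side p Upper = {1 - p..1}"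

definition cell_mass ::
    "nat \<Rightarrow> real \<Rightarrow> ((nat \<Rightarrow> real) \<Rightarrow> real) \<Rightarrow> (nat \<Rightarrow> label) \<Rightarrow> real" where
  "cell_mass d p C a = measure (law_of d C) (\<Pi>\<^sub>E i\<in>{1..d}. cell_side p (a i))"

definition tail_family :: "nat \<Rightarrow> real \<Rightarrow> ((nat \<Rightarrow> real) \<Rightarrow> real) \<Rightarrow> signed_family" where
  "tail_family d p C J \<tau> =
     1 / p * (\<Sum>a | a \<in> {1..d} \<rightarrow>\<^sub>E UNIV \<and> restrict a J = \<tau>. cell_mass d p C a)"

abbreviation unif01 :: "real measure" where
  "unif01 \<equiv> uniform_measure lborel {0..1}"

definition uniform_margins :: "nat \<Rightarrow> (nat \<Rightarrow> real) measure \<Rightarrow> bool" where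
  "uniform_margins d \<mu> \<longleftrightarrow> (\<forall>i\<in>{1..d}. distr \<mu> borel (\<lambda>x. x i) = unif01)"

text \<open>
  In the next two definitions the independent uniform variables are the coordinates of a product
  space.  The variables \<open>V\<^sub>i\<close> with \<open>i \<in> I\<close> are present in \<open>face_law\<close> but not used.
\<close>

definition face_law :: "nat \<Rightarrow> real \<Rightarrow> nat set \<Rightarrow> (nat \<Rightarrow> label) \<Rightarrow> (nat \<Rightarrow> real) measure" where
  "face_law d p I \<sigma> =
     distr (unif01 \<Otimes>\<^sub>M Pi\<^sub>M {1..d} (\<lambda>_. unif01)) (Pi\<^sub>M {1..d} (\<lambda>_. borel))
       (\<lambda>(z, v). \<lambda>i\<in>{1..d}.
          if i \<in> I then (if \<sigma> i = Lower then p * z else 1 - p * z)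
          else p + (1 - 2 * p) * v i)"

definition central_law :: "nat \<Rightarrow> real \<Rightarrow> (nat \<Rightarrow> real) measure" where
  "central_law d p =
     distr (Pi\<^sub>M {1..d} (\<lambda>_. unif01)) (Pi\<^sub>M {1..d} (\<lambda>_. borel))
       (\<lambda>v. \<lambda>i\<in>{1..d}. p + (1 - 2 * p) * v i)"

definition witness_law :: "nat \<Rightarrow> real \<Rightarrow> signed_family \<Rightarrow> (nat \<Rightarrow> real) measure" where
  "witness_law d p v =
     measure_of (space (Pi\<^sub>M {1..d} (\<lambda>_. borel :: real measure)))
       (sets (Pi\<^sub>M {1..d} (\<lambda>_. borel)))
       (\<lambda>A. ennreal (1 - p * total_weight d v) * emeasure (central_law d p) A +
          (\<Sum>(I, \<sigma>)\<in>signed_faces d. ennreal (p * v I \<sigma>) * emeasure (face_law d p I \<sigma>) A))"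

definition geometric_witness_copula :: "nat \<Rightarrow> real \<Rightarrow> ((nat \<Rightarrow> real) \<Rightarrow> real) \<Rightarrow> bool" where
  "geometric_witness_copula d p C \<longleftrightarrow> 0 < p \<and> p < 1 / 2 \<and>
     (\<exists>v. (\<forall>(I, \<sigma>)\<in>signed_faces d. 0 \<le> v I \<sigma>) \<and>
          0 \<le> 1 - p * total_weight d v \<and>
          uniform_margins d (witness_law d p v) \<and>
          C = distribution_function d (witness_law d p v))"

definition realizes :: "nat \<Rightarrow> real \<Rightarrow> signed_family \<Rightarrow> ((nat \<Rightarrow> real) \<Rightarrow> real) \<Rightarrow> bool" where
  "realizes d p lam C \<longleftrightarrow> geometric_witness_copula d p C \<and>
     (\<forall>(J, \<tau>)\<in>signed_faces d. tail_family d p C J \<tau> = lam J \<tau>)"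

end

theory Submission
  imports Defs
begin

text \<open>
  Let \<open>v\<close> be a weight system whose witness law at scale \<open>p\<close> makes sense.  Under the law attached
  to a face \<open>(I, \<sigma>)\<close>, coordinate \<open>i\<close> is uniformly distributed on the lower side, the middle part or
  the upper side of the unit interval, according to whether \<open>\<sigma> i\<close> is \<open>Lower\<close>, \<open>i \<notin> I\<close>, or \<open>\<sigma> i\<close> is
  \<open>Upper\<close> (\<open>distr_face_law_component\<close>).  Almost surely it avoids the thresholds, so the face law
  lives in a single cell, and distinct faces live in distinct cells (\<open>measure_face_law_cell\<close>).
  The mixture therefore puts mass \<open>p * v I \<sigma>\<close> on the cell of \<open>(I, \<sigma>)\<close> and the remaining mass on
  the central cell (\<open>cell_mass_face_label\<close>).

  Summing over the cells that extend \<open>(J, \<tau>)\<close>, the tail coefficient at \<open>(J, \<tau>)\<close> is the sum of \<open>v\<close>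
  over all faces extending \<open>(J, \<tau>)\<close> (\<open>tail_family_witness\<close>).  Triangular inversion solves exactly
  this system of equations, which has only one solution because it is triangular
  (\<open>coface_sum_tri_inv\<close>, \<open>tri_inv_unique\<close>).  So every witness that realizes \<open>\<lambda>\<close> has weights \<open>w\<close>, which
  gives the mass of its central cell, and conversely the weights \<open>w\<close> do realize \<open>\<lambda>\<close> as soon as
  they form a copula.

  They do so for small \<open>p\<close>.  The central mass \<open>1 - p * S(w)\<close> tends to \<open>1\<close> and is eventually
  nonnegative.  The hypothesis on singletons says that coordinate \<open>i\<close> has total mass \<open>p\<close> on the
  lower side and \<open>p\<close> on the upper side, hence \<open>1 - 2 * p\<close> in the middle; as it is uniform on each of
  the three parts, it is uniform on the unit interval (\<open>unif01_mixture\<close>,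
  \<open>uniform_margins_witness\<close>).
\<close>

(* Keeps {1..d} from being rewritten to {Suc 0..d}, on which facts about {1..d} would not match. *)
declare One_nat_def [simp del]

section \<open>Triangular inversion\<close>

text \<open>The linear map that \<^const>\<open>tri_inv\<close> inverts.\<close>

definition coface_sum :: "nat \<Rightarrow> signed_family \<Rightarrow> signed_family" where
  "coface_sum d v J \<tau> = (\<Sum>(K, \<rho>) | (K, \<rho>) \<in> signed_faces d \<and> J \<subseteq> K \<and> restrict \<rho> J = \<tau>. v K \<rho>)"

lemma finite_signs: "finite I \<Longrightarrow> finite (signs I)"
  unfolding signs_def by (intro finite_PiE) auto

lemma signed_faces_eq_Sigma: "signed_faces d = (SIGMA I : {I. I \<noteq> {} \<and> I \<subseteq> {1..d}}. signs I)"
  by (auto simp: signed_faces_def)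

lemma finite_signed_faces: "finite (signed_faces d)"
  unfolding signed_faces_eq_Sigma
  by (intro finite_SigmaI finite_signs) (auto intro: finite_subset)

text \<open>
  The only extension of a face with no further coordinates is the face itself.  Splitting it off
  exhibits the triangular shape and gives the sum the form that the recursion for \<^const>\<open>tri_inv\<close> uses.
\<close>

lemma coface_sum_split:
  assumes "(J, \<tau>) \<in> signed_faces d"
  shows "coface_sum d v J \<tau> = v J \<tau> +
    (\<Sum>K | J \<subset> K \<and> K \<subseteq> {1..d}. \<Sum>\<rho> | \<rho> \<in> signs K \<and> restrict \<rho> J = \<tau>. v K \<rho>)"
proof -
  let ?P = "{K. J \<subset> K \<and> K \<subseteq> {1..d}}"
  let ?R = "\<lambda>K. {\<rho>. \<rho> \<in> signs K \<and> restrict \<rho> J = \<tau>}"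
  have J: "J \<noteq> {}" "J \<subseteq> {1..d}" "\<tau> \<in> signs J"
    using assms by (auto simp: signed_faces_def)
  have restr: "restrict \<rho> J = \<rho>" if "\<rho> \<in> signs J" for \<rho>
    using that unfolding signs_def by (metis PiE_restrict)
  have "{(K, \<rho>). (K, \<rho>) \<in> signed_faces d \<and> J \<subseteq> K \<and> restrict \<rho> J = \<tau>} = 
      insert (J, \<tau>) (Sigma ?P ?R)"
    using J restr by (auto simp: signed_faces_def)
  then have "coface_sum d v J \<tau> = (\<Sum>(K, \<rho>)\<in>insert (J, \<tau>) (Sigma ?P ?R). v K \<rho>)"
    by (simp add: coface_sum_def)
  also have "\<dots> = v J \<tau> + (\<Sum>(K, \<rho>)\<in>Sigma ?P ?R. v K \<rho>)"
  proof (subst sum.insert)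
    show "finite (Sigma ?P ?R)"
      by (intro finite_SigmaI) (auto intro!: finite_subset[OF _ finite_signs] intro: finite_subset)
  qed auto
  also have "(\<Sum>(K, \<rho>)\<in>Sigma ?P ?R. v K \<rho>) = (\<Sum>K\<in>?P. \<Sum>\<rho>\<in>?R K. v K \<rho>)"
    by (intro sum.Sigma[symmetric])
      (auto intro!: finite_subset[OF _ finite_signs] intro: finite_subset)
  finally show ?thesis by simp
qed

lemma coface_sum_tri_inv:
  assumes "(J, \<tau>) \<in> signed_faces d"
  shows "coface_sum d (tri_inv d lam) J \<tau> = lam J \<tau>"
  using coface_sum_split[OF assms, of "tri_inv d lam"] tri_inv.simps[of d lam J \<tau>] by simp

text \<open>
  Descending induction on the face: once \<open>v\<close> is known on all proper extensions of \<open>(J, \<tau>)\<close>, the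
  equation at \<open>(J, \<tau>)\<close> determines \<open>v J \<tau>\<close> by the very recursion that defines \<^const>\<open>tri_inv\<close>.
\<close>

lemma tri_inv_unique:
  assumes v: "\<forall>(J, \<tau>)\<in>signed_faces d. coface_sum d v J \<tau> = lam J \<tau>"
    and "(J, \<tau>) \<in> signed_faces d"
  shows "v J \<tau> = tri_inv d lam J \<tau>"
  using assms(2)
proof (induction "card ({1..d} - J)" arbitrary: J \<tau> rule: less_induct)
  case less
  have "(\<Sum>K | J \<subset> K \<and> K \<subseteq> {1..d}. \<Sum>\<rho> | \<rho> \<in> signs K \<and> restrict \<rho> J = \<tau>. v K \<rho>) =
      (\<Sum>K | J \<subset> K \<and> K \<subseteq> {1..d}. \<Sum>\<rho> | \<rho> \<in> signs K \<and> restrict \<rho> J = \<tau>. tri_inv d lam K \<rho>)"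
  proof (intro sum.cong refl)
    fix K \<rho>
    assume K: "K \<in> {K. J \<subset> K \<and> K \<subseteq> {1..d}}"
      and \<rho>: "\<rho> \<in> {\<rho>. \<rho> \<in> signs K \<and> restrict \<rho> J = \<tau>}"
    have "{1..d} - K \<subset> {1..d} - J" using K by blast
    then have "card ({1..d} - K) < card ({1..d} - J)" by (intro psubset_card_mono) auto
    moreover have "(K, \<rho>) \<in> signed_faces d" using K \<rho> by (auto simp: signed_faces_def)
    ultimately show "v K \<rho> = tri_inv d lam K \<rho>" by (rule less.hyps)
  qed
  then show ?case
    using coface_sum_split[OF less.prems, of v] tri_inv.simps[of d lam J \<tau>] v less.prems by auto
qed

section \<open>Cells and faces\<close>

text \<open>
  The label of the cell that carries the law of a face.  Every cell label arises from exactly one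
  pair \<open>(I, \<sigma>)\<close>, where \<open>I\<close> is the set of coordinates that are not \<open>Middle\<close>; the empty \<open>I\<close> gives the
  central cell.
\<close>

definition face_label :: "nat \<Rightarrow> nat set \<Rightarrow> (nat \<Rightarrow> label) \<Rightarrow> nat \<Rightarrow> label" where
  "face_label d I \<sigma> = (\<lambda>i\<in>{1..d}. if i \<in> I then \<sigma> i else Middle)"

lemma face_label_PiE: "face_label d I \<sigma> \<in> {1..d} \<rightarrow>\<^sub>E UNIV"
  by (simp add: face_label_def)

lemma signs_not_Middle: "\<sigma> \<in> signs I \<Longrightarrow> i \<in> I \<Longrightarrow> \<sigma> i \<noteq> Middle"
  by (auto simp: signs_def PiE_iff)

lemma active_face_label:
  assumes "I \<subseteq> {1..d}" "\<sigma> \<in> signs I"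
  shows "{i\<in>{1..d}. face_label d I \<sigma> i \<noteq> Middle} = I"
  using assms signs_not_Middle by (auto simp: face_label_def)

lemma restrict_face_label:
  assumes "I \<subseteq> {1..d}" "\<sigma> \<in> signs I" "J \<subseteq> I"
  shows "restrict (face_label d I \<sigma>) J = restrict \<sigma> J"
  using assms by (auto simp: face_label_def fun_eq_iff restrict_def)

lemma face_label_eq_iff:
  assumes "I \<subseteq> {1..d}" "\<sigma> \<in> signs I" "K \<subseteq> {1..d}" "\<rho> \<in> signs K"
  shows "face_label d I \<sigma> = face_label d K \<rho> \<longleftrightarrow> I = K \<and> \<sigma> = \<rho>"
proof
  assume eq: "face_label d I \<sigma> = face_label d K \<rho>"
  then have "I = K" using active_face_label assms by metis
  moreover have "restrict \<sigma> I = restrict \<rho> I"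
    using restrict_face_label[of I d \<sigma> I] restrict_face_label[of K d \<rho> I] assms eq \<open>I = K\<close> by auto
  ultimately show "I = K \<and> \<sigma> = \<rho>"
    using assms unfolding signs_def by (metis PiE_restrict)
qed simp

lemma face_label_active:
  assumes "a \<in> {1..d} \<rightarrow>\<^sub>E UNIV" and "I = {i\<in>{1..d}. a i \<noteq> Middle}"
  shows "face_label d I (restrict a I) = a" "restrict a I \<in> signs I"
proof -
  show "face_label d I (restrict a I) = a"
    using assms by (auto simp: face_label_def fun_eq_iff PiE_iff extensional_def)
  have "a i \<in> {Lower, Upper}" if "i \<in> I" for i
    using that assms(2) by (cases "a i") auto
  then show "restrict a I \<in> signs I" by (auto simp: signs_def PiE_iff)
qed

lemma subset_active:
  assumes "J \<subseteq> {1..d}" "\<tau> \<in> signs J" "restrict a J = \<tau>"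
  shows "J \<subseteq> {i\<in>{1..d}. a i \<noteq> Middle}"
proof
  fix i assume "i \<in> J"
  then have "a i = \<tau> i" using assms(3) by auto
  then show "i \<in> {i\<in>{1..d}. a i \<noteq> Middle}" using \<open>i \<in> J\<close> assms signs_not_Middle by auto
qed

text \<open>
  A cell whose label agrees with \<open>\<tau>\<close> on \<open>J\<close> is active at least on \<open>J\<close>, because \<open>\<tau>\<close> never takes the
  value \<open>Middle\<close>.  So these cells correspond to the faces extending \<open>(J, \<tau>)\<close>; the central cell is
  not among them, as \<open>J\<close> is nonempty.
\<close>

lemma coface_sum_labels:
  assumes "(J, \<tau>) \<in> signed_faces d"
    and f: "\<And>K \<rho>. (K, \<rho>) \<in> signed_faces d \<Longrightarrow> f (face_label d K \<rho>) = v K \<rho>"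
  shows "(\<Sum>a | a \<in> {1..d} \<rightarrow>\<^sub>E UNIV \<and> restrict a J = \<tau>. f a) = coface_sum d v J \<tau>"
proof -
  have J: "J \<noteq> {}" "J \<subseteq> {1..d}" "\<tau> \<in> signs J"
    using assms(1) by (auto simp: signed_faces_def)
  let ?act = "\<lambda>a. {i\<in>{1..d}. a i \<noteq> Middle}"
  show ?thesis unfolding coface_sum_def
  proof (rule sum.reindex_bij_witness[where i = "\<lambda>(K, \<rho>). face_label d K \<rho>"
        and j = "\<lambda>a. (?act a, restrict a (?act a))"], goal_cases)
    case (1 a)
    then show ?case using face_label_active(1)[of a d] by auto
  next
    case (2 a)
    have "J \<subseteq> ?act a" using 2 J by (intro subset_active) auto
    moreover have "restrict (restrict a (?act a)) J = restrict a J"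
      using calculation by (simp add: Int_absorb1)
    ultimately show ?case
      using 2 face_label_active(2)[of a d] J by (auto simp: signed_faces_def)
  next
    case (3 b)
    then obtain K \<rho> where b: "b = (K, \<rho>)" "(K, \<rho>) \<in> signed_faces d" "J \<subseteq> K" "restrict \<rho> J = \<tau>"
      by auto
    have K: "K \<subseteq> {1..d}" "\<rho> \<in> signs K" using b by (auto simp: signed_faces_def)
    then have "restrict (face_label d K \<rho>) K = \<rho>"
      by (metis order_refl restrict_face_label PiE_restrict signs_def)
    then show ?case using active_face_label[OF K] by (simp add: b)
  next
    case (4 b)
    then obtain K \<rho> where b: "b = (K, \<rho>)" "(K, \<rho>) \<in> signed_faces d" "J \<subseteq> K" "restrict \<rho> J = \<tau>"
      by auto
    then show ?case
      using restrict_face_label[of K d \<rho> J] face_label_PiE[of d K \<rho>]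
      by (auto simp: signed_faces_def)
  next
    case (5 a)
    have "J \<subseteq> ?act a" using 5 J by (intro subset_active) auto
    then have "(?act a, restrict a (?act a)) \<in> signed_faces d"
      using 5 face_label_active(2)[of a d] J by (auto simp: signed_faces_def)
    from f[OF this] show ?case using face_label_active(1)[of a d] 5 by auto
  qed
qed

section \<open>One coordinate of a face law\<close>

text \<open>
  The affine map by which a uniform variable enters a coordinate with the given label; for
  \<open>0 < p < 1/2\<close> it maps \<open>[0, 1]\<close> onto \<^term>\<open>cell_side p l\<close>.
\<close>

fun side_map :: "real \<Rightarrow> label \<Rightarrow> real \<Rightarrow> real" where
  "side_map p Lower = (\<lambda>z. p * z)"
| "side_map p Middle = (\<lambda>z. p + (1 - 2 * p) * z)"
| "side_map p Upper = (\<lambda>z. 1 - p * z)"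

abbreviation side_law :: "real \<Rightarrow> label \<Rightarrow> real measure" where
  "side_law p l \<equiv> distr unif01 borel (side_map p l)"

lemma prob_space_unif01: "prob_space unif01"
  by (rule prob_space_uniform_measure) auto

lemma measurable_unif01D:
  assumes "f \<in> measurable M unif01"
  shows "f \<in> borel_measurable M"
proof -
  have "sets unif01 = sets (borel :: real measure)" by simp
  then show ?thesis using assms measurable_cong_sets[OF refl] by blast
qed

lemma side_map_measurable [measurable]: "side_map p l \<in> borel_measurable borel"
  by (cases l) simp_all

lemma AE_unif01: "AE z in unif01. 0 < z \<and> z < 1"
proof (rule AE_uniform_measureI)
  have "AE z in lborel. z \<noteq> (0::real)" "AE z in lborel. z \<noteq> (1::real)"
    by (rule AE_lborel_singleton)+
  then show "AE z in lborel. z \<in> {0..1} \<longrightarrow> 0 < z \<and> z < (1::real)"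
    by eventually_elim auto
qed simp

text \<open>
  The sides overlap in the threshold points, which are images of \<open>0\<close> and \<open>1\<close>; this is why \<open>z\<close>
  ranges over the open interval.
\<close>

lemma side_map_mem_cell_side_iff:
  assumes "0 < p" "p < 1 / 2" "0 < z" "z < 1"
  shows "side_map p l z \<in> cell_side p l' \<longleftrightarrow> l = l'"
proof -
  define s t where "s = p * z" and "t = (1 - 2 * p) * z"
  have "s < p * 1" "t < (1 - 2 * p) * 1"
    unfolding s_def t_def using assms by (intro mult_strict_left_mono; simp)+
  moreover have "0 < s" "0 < t" unfolding s_def t_def using assms by auto
  moreover have "side_map p l z = (case l of Lower \<Rightarrow> s | Middle \<Rightarrow> p + t | Upper \<Rightarrow> 1 - s)"
    by (cases l) (simp_all add: s_def t_def)
  ultimately show ?thesis using assms by (cases l; cases l') auto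
qed

text \<open>
  Multiplying by \<open>\<bar>c\<bar>\<close> instead of dividing the right-hand side by it lets the three sides be added
  up later as plain Lebesgue measures.
\<close>

lemma emeasure_unif01_affine:
  assumes "c \<noteq> 0" and A [measurable]: "A \<in> sets borel"
  shows "ennreal \<bar>c\<bar> * emeasure (distr unif01 borel (\<lambda>z. t + c * z)) A =
    emeasure lborel (A \<inter> (\<lambda>z. t + c * z) ` {0..1})"
proof -
  let ?h = "\<lambda>z. t + c * z"
  have img [measurable]: "?h ` {0..1} \<in> sets borel"
    by (intro borel_compact compact_continuous_image continuous_intros compact_Icc)
  have inj: "?h x \<in> ?h ` {0..1} \<longleftrightarrow> x \<in> {0..1}" for x
    using \<open>c \<noteq> 0\<close> by auto
  have pre [measurable]: "?h -` A \<in> sets borel"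
    using measurable_sets[of ?h borel borel A] by simp
  have "emeasure (distr unif01 borel ?h) A = emeasure lborel ({0..1} \<inter> ?h -` A)"
    by (simp add: emeasure_distr emeasure_uniform_measure divide_ennreal_def)
  moreover have "emeasure lborel (A \<inter> ?h ` {0..1}) =
      ennreal \<bar>c\<bar> * (\<integral>\<^sup>+x. indicator (A \<inter> ?h ` {0..1}) (?h x) \<partial>lborel)"
    using nn_integral_real_affine[of "indicator (A \<inter> ?h ` {0..1})" c t] \<open>c \<noteq> 0\<close> by simp
  moreover have "(\<integral>\<^sup>+x. indicator (A \<inter> ?h ` {0..1}) (?h x) \<partial>lborel) =
      (\<integral>\<^sup>+x. indicator ({0..1} \<inter> ?h -` A) x \<partial>lborel)"
    using inj by (intro nn_integral_cong) (auto simp: indicator_def)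
  ultimately show ?thesis by simp
qed

fun side_width :: "real \<Rightarrow> label \<Rightarrow> real" where
  "side_width p Middle = 1 - 2 * p"
| "side_width p _ = p"

lemma emeasure_side_law:
  assumes p: "0 < p" "p < 1 / 2" and A: "A \<in> sets borel"
  shows "ennreal (side_width p l) * emeasure (side_law p l) A = emeasure lborel (A \<inter> cell_side p l)"
proof (cases l)
  case Lower
  have "(\<lambda>z. 0 + p * z) ` {0..1} = {0..p}" using p by (simp add: image_affinity_atLeastAtMost)
  then show ?thesis using emeasure_unif01_affine[of p A 0] p A Lower by (simp add: comp_def)
next
  case Middle
  have "(\<lambda>z. (1 - 2 * p) * z + p) ` {0..1} = {p..1 - p}"
    using p by (subst image_affinity_atLeastAtMost) auto
  then have "(\<lambda>z. p + (1 - 2 * p) * z) ` {0..1} = {p..1 - p}"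
    by (simp only: add.commute[of p])
  then show ?thesis using emeasure_unif01_affine[of "1 - 2 * p" A p] p A Middle by simp
next
  case Upper
  have "(\<lambda>z. 1 + (- p) * z) ` {0..1} = {1 - p..1}"
    using p image_affinity_atLeastAtMost[of "-p" 1 0 1] by (simp add: add.commute)
  then show ?thesis using emeasure_unif01_affine[of "- p" A 1] p A Upper by simp
qed

text \<open>
  Weighted by its length, the uniform law on a side is the restriction of Lebesgue measure to that
  side, and the three sides partition the unit interval up to two points.
\<close>

lemma unif01_mixture:
  assumes p: "0 < p" "p < 1 / 2" and A [measurable]: "A \<in> sets borel"
  shows "p * measure (side_law p Lower) A + (1 - 2 * p) * measure (side_law p Middle) A +
    p * measure (side_law p Upper) A = measure unif01 A"
proof -
  have side: "side_width p l * measure (side_law p l) A = measure lborel (A \<inter> cell_side p l)" for l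
  proof -
    have "0 \<le> side_width p l" using p by (cases l) auto
    moreover have "enn2real (ennreal (side_width p l) * emeasure (side_law p l) A) =
        enn2real (emeasure lborel (A \<inter> cell_side p l))"
      by (rule arg_cong[OF emeasure_side_law[OF p A]])
    ultimately show ?thesis by (simp add: measure_def enn2real_mult)
  qed
  have join: "measure lborel (A \<inter> {a..c}) = measure lborel (A \<inter> {a..b}) + measure lborel (A \<inter> {b..c})"
    if "a \<le> b" "b \<le> c" for a b c :: real
  proof -
    have ivl: "A \<inter> {x..y} \<in> fmeasurable lborel" for x y
      by (rule fmeasurableI2[of "{x..y}"], rule fmeasurableI) (simp_all add: emeasure_lborel_Icc_eq)
    have "A \<inter> {a..c} = (A \<inter> {a..b}) \<union> (A \<inter> {b..c})" using that by auto
    moreover have "AE x in lborel. x \<notin> A \<inter> {a..b} \<or> x \<notin> A \<inter> {b..c}"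
      using AE_lborel_singleton[of b] by (rule AE_mp) (rule AE_I2, auto)
    ultimately show ?thesis
      by (simp only: measure_Un_AE[OF _ ivl ivl])
  qed
  have "measure unif01 A = measure lborel (A \<inter> {0..1})"
    by (simp add: measure_def emeasure_uniform_measure divide_ennreal_def Int_commute)
  moreover have "measure lborel (A \<inter> {0..1}) = measure lborel (A \<inter> {0..p}) + measure lborel (A \<inter> {p..1})"
    "measure lborel (A \<inter> {p..1}) = measure lborel (A \<inter> {p..1-p}) + measure lborel (A \<inter> {1-p..1})"
    using p by (intro join; simp)+
  ultimately show ?thesis
    using side[of Lower] side[of Middle] side[of Upper]
    unfolding side_width.simps cell_side.simps by linarith
qed

section \<open>Face laws\<close>

lemma face_map_measurable:
  "(\<lambda>(z, v). \<lambda>i\<in>{1..d}. if i \<in> I then (if \<sigma> i = Lower then p * z else 1 - p * z)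
       else p + (1 - 2 * p) * v i)
    \<in> measurable (unif01 \<Otimes>\<^sub>M Pi\<^sub>M {1..d} (\<lambda>_. unif01)) (Pi\<^sub>M {1..d} (\<lambda>_. borel))"
proof -
  have [measurable]: "(\<lambda>x. snd x i) \<in> borel_measurable (unif01 \<Otimes>\<^sub>M Pi\<^sub>M {1..d} (\<lambda>_. unif01))"
    if "i \<in> {1..d}" for i
    by (rule measurable_unif01D) (use that in measurable)
  have [measurable]: "fst \<in> borel_measurable (unif01 \<Otimes>\<^sub>M Pi\<^sub>M {1..d} (\<lambda>_. unif01))"
    by (rule measurable_unif01D[OF measurable_fst])
  show ?thesis unfolding split_beta
    by (rule measurable_restrict) (auto simp: measurable_If)
qed

lemma prob_space_middle_variables: "prob_space (Pi\<^sub>M {1..d::nat} (\<lambda>_. unif01))"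
  by (intro prob_space_PiM prob_space_unif01)

lemma prob_space_face_variables: "prob_space (unif01 \<Otimes>\<^sub>M Pi\<^sub>M {1..d::nat} (\<lambda>_. unif01))"
  by (rule prob_space_pair[OF prob_space_unif01 prob_space_middle_variables])

lemma prob_space_face_law: "prob_space (face_law d p I \<sigma>)"
  unfolding face_law_def
  by (rule prob_space.prob_space_distr[OF prob_space_face_variables face_map_measurable])

lemma sets_face_law [simp, measurable_cong]: "sets (face_law d p I \<sigma>) = sets (Pi\<^sub>M {1..d} (\<lambda>_. borel))"
  by (simp add: face_law_def)

lemma distr_snd_middle_variables:
  "distr (unif01 \<Otimes>\<^sub>M Pi\<^sub>M {1..d::nat} (\<lambda>_. unif01)) (Pi\<^sub>M {1..d} (\<lambda>_. unif01)) snd =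
   Pi\<^sub>M {1..d} (\<lambda>_. unif01)"
proof -
  let ?V = "Pi\<^sub>M {1..d} (\<lambda>_. unif01)"
  interpret U: prob_space unif01 by (rule prob_space_unif01)
  interpret V: prob_space ?V by (rule prob_space_middle_variables)
  interpret pair_sigma_finite unif01 ?V ..
  have "distr (unif01 \<Otimes>\<^sub>M ?V) ?V snd = distr (?V \<Otimes>\<^sub>M unif01) ?V (snd \<circ> (\<lambda>(x, y). (y, x)))"
    by (subst distr_pair_swap, subst distr_distr) auto
  also have "snd \<circ> (\<lambda>(x, y). (y, x)) = (fst :: (nat \<Rightarrow> real) \<times> real \<Rightarrow> _)"
    by (auto simp: fun_eq_iff)
  also have "distr (?V \<Otimes>\<^sub>M unif01) ?V fst = ?V" by (rule U.distr_pair_fst)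
  finally show ?thesis .
qed

text \<open>
  The central law is the face law of the empty face, in which the common variable \<open>Z\<close> moves no
  coordinate.  This lets every component of a witness law be treated as a face law.
\<close>

lemma central_law_eq_face_law: "central_law d p = face_law d p {} \<sigma>"
proof -
  have m: "(\<lambda>v. \<lambda>i\<in>{1..d}. p + (1 - 2 * p) * v i) \<in>
      measurable (Pi\<^sub>M {1..d} (\<lambda>_. unif01)) (Pi\<^sub>M {1..d} (\<lambda>_. borel))"
  proof (rule measurable_restrict)
    fix i assume "i \<in> {1..d}"
    then have [measurable]: "(\<lambda>v. v i) \<in> borel_measurable (Pi\<^sub>M {1..d} (\<lambda>_. unif01))"
      by (intro measurable_unif01D) measurable
    show "(\<lambda>v. p + (1 - 2 * p) * v i) \<in> borel_measurable (Pi\<^sub>M {1..d} (\<lambda>_. unif01))" by measurable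
  qed
  show ?thesis
    unfolding central_law_def
    by (subst distr_snd_middle_variables[symmetric], subst distr_distr[OF m])
      (simp_all add: face_law_def comp_def split_beta')
qed

lemma distr_face_law_component:
  assumes i: "i \<in> {1..d}" and I: "\<sigma> \<in> signs I"
  shows "distr (face_law d p I \<sigma>) borel (\<lambda>x. x i) = side_law p (face_label d I \<sigma> i)"
proof -
  let ?Q = "unif01 \<Otimes>\<^sub>M Pi\<^sub>M {1..d} (\<lambda>_. unif01)"
  have fst: "distr ?Q unif01 fst = unif01"
    by (rule prob_space.distr_pair_fst[OF prob_space_middle_variables])
  have snd: "distr ?Q unif01 (\<lambda>x. snd x i) = unif01"
  proof -
    have "distr ?Q unif01 (\<lambda>x. snd x i) =
        distr (distr ?Q (Pi\<^sub>M {1..d} (\<lambda>_. unif01)) snd) unif01 (\<lambda>v. v i)"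
      using i by (subst distr_distr) (auto simp: comp_def)
    also have "\<dots> = unif01"
      unfolding distr_snd_middle_variables using i by (intro distr_PiM_component prob_space_unif01) auto
    finally show ?thesis .
  qed
  have sm: "side_map p l \<in> measurable unif01 borel" for l by simp
  have mi: "(\<lambda>x. snd x i) \<in> measurable ?Q unif01" using i by measurable
  have "distr (face_law d p I \<sigma>) borel (\<lambda>x. x i) = distr ?Q borel (\<lambda>x.
      if i \<in> I then (if \<sigma> i = Lower then p * fst x else 1 - p * fst x) else p + (1 - 2 * p) * snd x i)"
    unfolding face_law_def using i
    by (subst distr_distr[OF _ face_map_measurable]) (auto simp: comp_def split_beta)
  also have "\<dots> = side_law p (face_label d I \<sigma> i)"
  proof (cases "i \<in> I")
    case True
    then have "\<sigma> i = Lower \<or> \<sigma> i = Upper" using I by (auto simp: signs_def PiE_iff)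
    then have "distr ?Q borel (\<lambda>x. if i \<in> I then (if \<sigma> i = Lower then p * fst x else 1 - p * fst x)
        else p + (1 - 2 * p) * snd x i) = distr ?Q borel (side_map p (\<sigma> i) \<circ> fst)"
      using True by (auto simp: comp_def)
    also have "\<dots> = side_law p (\<sigma> i)"
      by (subst distr_distr[OF sm measurable_fst, symmetric]) (simp add: fst)
    finally show ?thesis using True i by (simp add: face_label_def)
  next
    case False
    have "distr ?Q borel (\<lambda>x. p + (1 - 2 * p) * snd x i) = distr ?Q borel (side_map p Middle \<circ> (\<lambda>x. snd x i))"
      by (simp add: comp_def)
    also have "\<dots> = side_law p Middle"
      by (subst distr_distr[OF sm mi, symmetric]) (simp add: snd)
    finally show ?thesis using False i by (simp add: face_label_def)
  qed
  finally show ?thesis .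
qed

text \<open>
  Each single coordinate almost surely lies in the interior of its own side, hence in the side named
  by \<open>a i\<close> only if the labels agree.  Finitely many almost sure statements hold simultaneously, so
  the laws of the single coordinates decide the cell even though \<open>Z\<close> makes them dependent.
\<close>

lemma measure_face_law_cell:
  assumes p: "0 < p" "p < 1 / 2" and a: "a \<in> {1..d} \<rightarrow>\<^sub>E UNIV" and I: "\<sigma> \<in> signs I"
  shows "measure (face_law d p I \<sigma>) (\<Pi>\<^sub>E i\<in>{1..d}. cell_side p (a i)) =
    (if a = face_label d I \<sigma> then 1 else 0)"
proof -
  interpret prob_space "face_law d p I \<sigma>" by (rule prob_space_face_law)
  let ?B = "\<Pi>\<^sub>E i\<in>{1..d}. cell_side p (a i)"
  have "AE x in face_law d p I \<sigma>. x i \<in> cell_side p (a i) \<longleftrightarrow> face_label d I \<sigma> i = a i"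
    if "i \<in> {1..d}" for i
  proof (rule AE_distrD[where f = "\<lambda>x. x i" and M' = borel])
    show "(\<lambda>x. x i) \<in> borel_measurable (face_law d p I \<sigma>)" using that by measurable
    have "AE z in unif01. side_map p (face_label d I \<sigma> i) z \<in> cell_side p (a i) \<longleftrightarrow>
        face_label d I \<sigma> i = a i"
      using AE_unif01 by eventually_elim (rule side_map_mem_cell_side_iff, use p in auto)
    moreover have "{y. y \<in> cell_side p (a i) \<longleftrightarrow> face_label d I \<sigma> i = a i} \<in> sets borel"
      by (cases "a i"; cases "face_label d I \<sigma> i = a i") (auto simp: Compl_eq[symmetric])
    ultimately show "AE y in distr (face_law d p I \<sigma>) borel (\<lambda>x. x i).
        y \<in> cell_side p (a i) \<longleftrightarrow> face_label d I \<sigma> i = a i"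
      unfolding distr_face_law_component[OF that I] by (subst AE_distr_iff) auto
  qed
  then have "AE x in face_law d p I \<sigma>. \<forall>i\<in>{1..d}. x i \<in> cell_side p (a i) \<longleftrightarrow> face_label d I \<sigma> i = a i"
    by (intro AE_finite_allI) auto
  then have ae: "AE x in face_law d p I \<sigma>. x \<in> ?B \<longleftrightarrow> a = face_label d I \<sigma>"
    using AE_space
  proof eventually_elim
    case (elim x)
    have "x \<in> extensional {1..d}" using elim by (auto simp: face_law_def space_PiM PiE_iff)
    moreover have "a = face_label d I \<sigma> \<longleftrightarrow> (\<forall>i\<in>{1..d}. face_label d I \<sigma> i = a i)"
      using a face_label_PiE[of d I \<sigma>] by (metis PiE_ext)
    ultimately show ?case using elim by (auto simp: PiE_iff)
  qed
  have "cell_side p l \<in> sets borel" for l by (cases l) auto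
  then have B: "?B \<in> sets (face_law d p I \<sigma>)" by (auto intro!: sets_PiM_I_finite)
  show ?thesis
  proof (cases "a = face_label d I \<sigma>")
    case True
    then show ?thesis using ae prob_eq_1[OF B] by simp
  next
    case False
    then have "AE x in face_law d p I \<sigma>. x \<notin> ?B" using ae by simp
    then show ?thesis using prob_eq_0[OF B] False by simp
  qed
qed

section \<open>Witness laws\<close>

locale witness =
  fixes d :: nat and p :: real and v :: signed_family
  assumes p: "0 < p" "p < 1 / 2"
    and nonneg: "(I, \<sigma>) \<in> signed_faces d \<Longrightarrow> 0 \<le> v I \<sigma>"
    and central_nonneg: "0 \<le> 1 - p * total_weight d v"
begin

lemma sets_witness_law [simp, measurable_cong]:
  "sets (witness_law d p v) = sets (Pi\<^sub>M {1..d} (\<lambda>_. borel))"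
  unfolding witness_law_def by (rule sets.sets_measure_of_eq)

lemma emeasure_witness_law:
  assumes "A \<in> sets (Pi\<^sub>M {1..d} (\<lambda>_. borel))"
  shows "emeasure (witness_law d p v) A =
    ennreal (1 - p * total_weight d v) * emeasure (central_law d p) A +
    (\<Sum>(I, \<sigma>)\<in>signed_faces d. ennreal (p * v I \<sigma>) * emeasure (face_law d p I \<sigma>) A)"
  unfolding witness_law_def
proof (rule emeasure_measure_of_sigma)
  let ?M = "Pi\<^sub>M {1..d} (\<lambda>_. borel :: real measure)"
  let ?\<mu> = "\<lambda>A. ennreal (1 - p * total_weight d v) * emeasure (central_law d p) A +
    (\<Sum>(I, \<sigma>)\<in>signed_faces d. ennreal (p * v I \<sigma>) * emeasure (face_law d p I \<sigma>) A)"
  show "sigma_algebra (space ?M) (sets ?M)" by (rule sets.sigma_algebra_axioms)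
  show "positive (sets ?M) ?\<mu>" by (auto simp: positive_def)
  show "countably_additive (sets ?M) ?\<mu>"
  proof (rule countably_additiveI)
    fix F :: "nat \<Rightarrow> (nat \<Rightarrow> real) set"
    assume F: "range F \<subseteq> sets ?M" "disjoint_family F"
    have face: "(\<Sum>n. emeasure (face_law d p I \<sigma>) (F n)) = emeasure (face_law d p I \<sigma>) (\<Union> (range F))"
      for I \<sigma>
      using F by (intro suminf_emeasure) auto
    have "(\<Sum>n. ?\<mu> (F n)) =
        (\<Sum>n. ennreal (1 - p * total_weight d v) * emeasure (central_law d p) (F n)) +
        (\<Sum>n. \<Sum>(I, \<sigma>)\<in>signed_faces d. ennreal (p * v I \<sigma>) * emeasure (face_law d p I \<sigma>) (F n))"
      by (intro suminf_add[symmetric] summableI)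
    also have "\<dots> = ?\<mu> (\<Union> (range F))"
      by (simp add: suminf_sum split_beta central_law_eq_face_law[of d p undefined] face)
    finally show "(\<Sum>n. ?\<mu> (F n)) = ?\<mu> (\<Union> (range F))" .
  qed
  show "A \<in> sets ?M" by fact
qed

text \<open>
  Real coefficients and measures make the sums below amenable to ordinary algebra, and writing the
  central law as the law of the empty face lets one computation cover all components.
\<close>

lemma emeasure_witness_law_eq_ennreal:
  assumes "A \<in> sets (Pi\<^sub>M {1..d} (\<lambda>_. borel))"
  shows "emeasure (witness_law d p v) A =
    ennreal ((1 - p * total_weight d v) * measure (face_law d p {} \<sigma>) A +
    (\<Sum>(I, \<sigma>)\<in>signed_faces d. p * v I \<sigma> * measure (face_law d p I \<sigma>) A))"
proof -
  have fin: "emeasure (face_law d p I \<sigma>) A = ennreal (measure (face_law d p I \<sigma>) A)" for I \<sigma>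
    using prob_space_face_law[of d p I \<sigma>] 
    by (simp add: prob_space_def finite_measure.emeasure_eq_measure)
  have "(\<Sum>(I, \<sigma>)\<in>signed_faces d. ennreal (p * v I \<sigma>) * emeasure (face_law d p I \<sigma>) A) =
      (\<Sum>(I, \<sigma>)\<in>signed_faces d. ennreal (p * v I \<sigma> * measure (face_law d p I \<sigma>) A))"
    using p nonneg by (intro sum.cong) (auto simp: fin ennreal_mult)
  also have "\<dots> = ennreal (\<Sum>(I, \<sigma>)\<in>signed_faces d. p * v I \<sigma> * measure (face_law d p I \<sigma>) A)"
    using p nonneg unfolding split_beta by (intro sum_ennreal) auto
  moreover have "0 \<le> (\<Sum>(I, \<sigma>)\<in>signed_faces d. p * v I \<sigma> * measure (face_law d p I \<sigma>) A)"
    using p nonneg by (intro sum_nonneg) auto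
  ultimately show ?thesis
    using emeasure_witness_law[OF assms] central_nonneg
    by (simp add: central_law_eq_face_law[of d p \<sigma>] fin ennreal_mult)
qed

lemma measure_witness_law:
  assumes "A \<in> sets (Pi\<^sub>M {1..d} (\<lambda>_. borel))"
  shows "measure (witness_law d p v) A =
    (1 - p * total_weight d v) * measure (face_law d p {} \<sigma>) A +
    (\<Sum>(I, \<sigma>)\<in>signed_faces d. p * v I \<sigma> * measure (face_law d p I \<sigma>) A)"
proof -
  have "0 \<le> (\<Sum>(I, \<sigma>)\<in>signed_faces d. p * v I \<sigma> * measure (face_law d p I \<sigma>) A)"
    using p nonneg by (intro sum_nonneg) auto
  then show ?thesis
    using central_nonneg
    by (subst measure_def, subst emeasure_witness_law_eq_ennreal[OF assms, of \<sigma>])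
      (intro enn2real_ennreal add_nonneg_nonneg mult_nonneg_nonneg measure_nonneg, auto)
qed

lemma prob_space_witness_law: "prob_space (witness_law d p v)"
proof
  let ?S = "space (Pi\<^sub>M {1..d} (\<lambda>_. borel :: real measure))"
  have [simp]: "measure (face_law d p I \<sigma>) ?S = 1" for I \<sigma>
    using prob_space.prob_space[OF prob_space_face_law[of d p I \<sigma>]] by (simp add: face_law_def)
  have "emeasure (witness_law d p v) ?S =
      ennreal ((1 - p * total_weight d v) + (\<Sum>(I, \<sigma>)\<in>signed_faces d. p * v I \<sigma>))"
    by (subst emeasure_witness_law_eq_ennreal[of _ undefined]) auto
  also have "(\<Sum>(I, \<sigma>)\<in>signed_faces d. p * v I \<sigma>) = p * total_weight d v"
    by (simp add: total_weight_def sum_distrib_left split_beta)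
  finally show "emeasure (witness_law d p v) (space (witness_law d p v)) = 1"
    using sets_eq_imp_space_eq[OF sets_witness_law] by simp
qed

lemma law_of_witness: "law_of d (distribution_function d (witness_law d p v)) = witness_law d p v"
  by (rule law_of_distribution_function[OF prob_space_witness_law sets_witness_law])

lemma cell_mass_face_label:
  assumes K: "K \<subseteq> {1..d}" "\<rho> \<in> signs K"
  shows "cell_mass d p (distribution_function d (witness_law d p v)) (face_label d K \<rho>) =
    (if K = {} then 1 - p * total_weight d v else p * v K \<rho>)"
proof -
  let ?B = "\<Pi>\<^sub>E i\<in>{1..d}. cell_side p (face_label d K \<rho> i)"
  obtain \<sigma>0 where \<sigma>0: "\<sigma>0 \<in> signs {}" by (simp add: signs_def)
  have "cell_side p l \<in> sets borel" for l by (cases l) auto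
  then have B: "?B \<in> sets (Pi\<^sub>M {1..d} (\<lambda>_. borel))" by (auto intro!: sets_PiM_I_finite)
  have face: "measure (face_law d p I \<sigma>) ?B = (if K = I \<and> \<rho> = \<sigma> then 1 else 0)"
    if "I \<subseteq> {1..d}" "\<sigma> \<in> signs I" for I \<sigma>
    using measure_face_law_cell[OF p face_label_PiE that(2)] face_label_eq_iff[OF K that] by simp
  have "(\<Sum>(I, \<sigma>)\<in>signed_faces d. p * v I \<sigma> * measure (face_law d p I \<sigma>) ?B) =
      (\<Sum>F\<in>signed_faces d. if (K, \<rho>) = F then p * v K \<rho> else 0)"
    by (intro sum.cong) (auto simp: face signed_faces_def split: if_splits)
  also have "\<dots> = (if K = {} then 0 else p * v K \<rho>)"
    using K by (simp add: finite_signed_faces) (simp add: signed_faces_def)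
  finally show ?thesis
    unfolding cell_mass_def law_of_witness measure_witness_law[OF B, of \<sigma>0]
    using face[OF _ \<sigma>0] \<sigma>0 K by (auto simp: signs_def)
qed

lemma tail_family_witness:
  assumes "(J, \<tau>) \<in> signed_faces d"
  shows "tail_family d p (distribution_function d (witness_law d p v)) J \<tau> = coface_sum d v J \<tau>"
proof -
  have "(\<Sum>a | a \<in> {1..d} \<rightarrow>\<^sub>E UNIV \<and> restrict a J = \<tau>.
      1 / p * cell_mass d p (distribution_function d (witness_law d p v)) a) = coface_sum d v J \<tau>"
    using p by (intro coface_sum_labels[OF assms]) (auto simp: signed_faces_def cell_mass_face_label)
  then show ?thesis by (simp add: tail_family_def sum_distrib_left)
qed

lemma cell_mass_central:
  "cell_mass d p (distribution_function d (witness_law d p v)) (\<lambda>i\<in>{1..d}. Middle) =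
    1 - p * total_weight d v"
  using cell_mass_face_label[of "{}" "\<lambda>_. undefined"] by (simp add: face_label_def signs_def)

text \<open>
  The faces are sorted by the label they give to coordinate \<open>i\<close>.  By hypothesis those with label
  \<open>Lower\<close> have total weight \<open>1\<close>, and so have those with label \<open>Upper\<close>.  Whatever the total weight of
  the faces with label \<open>Middle\<close> is, together with the central law they carry the remaining mass
  \<open>1 - 2 * p\<close>.
\<close>

lemma uniform_margins_witness:
  assumes tails: "\<forall>i\<in>{1..d}. coface_sum d v {i} (\<lambda>j\<in>{i}. Lower) = 1 \<and>
    coface_sum d v {i} (\<lambda>j\<in>{i}. Upper) = 1"
  shows "uniform_margins d (witness_law d p v)"
  unfolding uniform_margins_def
proof
  fix i assume i: "i \<in> {1..d}"
  interpret W: prob_space "witness_law d p v" by (rule prob_space_witness_law)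
  have mi [measurable]: "(\<lambda>x. x i) \<in> borel_measurable (Pi\<^sub>M {1..d} (\<lambda>_. borel :: real measure))"
    using i by measurable
  show "distr (witness_law d p v) borel (\<lambda>x. x i) = unif01"
  proof (rule measure_eqI)
    fix A assume "A \<in> sets (distr (witness_law d p v) borel (\<lambda>x. x i))"
    then have A [measurable]: "A \<in> sets borel" by simp
    let ?m = "\<lambda>l. measure (side_law p l) A"
    (* the total weight of the faces that send coordinate i to side l *)
    let ?c = "\<lambda>l. \<Sum>(I, \<sigma>)\<in>signed_faces d. if face_label d I \<sigma> i = l then v I \<sigma> else 0"
    let ?A = "(\<lambda>x. x i) -` A \<inter> space (Pi\<^sub>M {1..d} (\<lambda>_. borel :: real measure))"
    have face: "measure (face_law d p I \<sigma>) ?A = ?m (face_label d I \<sigma> i)" if "\<sigma> \<in> signs I" for I \<sigma>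
      using distr_face_law_component[OF i that, of p, symmetric]
      by (simp add: measure_distr face_law_def)
    have c: "?c l = 1" if "l \<in> {Lower, Upper}" for l
    proof -
      have "?c l = (\<Sum>(I, \<sigma>)\<in>{F\<in>signed_faces d. face_label d (fst F) (snd F) i = l}. v I \<sigma>)"
        by (simp add: sum.inter_filter[OF finite_signed_faces] split_beta)
      also have "{F\<in>signed_faces d. face_label d (fst F) (snd F) i = l} =
          {(K, \<rho>). (K, \<rho>) \<in> signed_faces d \<and> {i} \<subseteq> K \<and> restrict \<rho> {i} = (\<lambda>j\<in>{i}. l)}"
        using that i by (auto simp: face_label_def fun_eq_iff restrict_def split: if_splits)
      also have "(\<Sum>(I, \<sigma>)\<in>\<dots>. v I \<sigma>) = coface_sum d v {i} (\<lambda>j\<in>{i}. l)"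
        by (simp add: coface_sum_def)
      also have "\<dots> = 1" using tails i that by auto
      finally show ?thesis .
    qed
    have weight: "total_weight d v = ?c Lower + ?c Middle + ?c Upper"
      unfolding total_weight_def sum.distrib[symmetric]
    proof (intro sum.cong refl)
      fix F assume "F \<in> signed_faces d"
      show "(case F of (I, \<sigma>) \<Rightarrow> v I \<sigma>) =
          (case F of (I, \<sigma>) \<Rightarrow> if face_label d I \<sigma> i = Lower then v I \<sigma> else 0) +
          (case F of (I, \<sigma>) \<Rightarrow> if face_label d I \<sigma> i = Middle then v I \<sigma> else 0) +
          (case F of (I, \<sigma>) \<Rightarrow> if face_label d I \<sigma> i = Upper then v I \<sigma> else 0)"
        by (cases "face_label d (fst F) (snd F) i") (auto simp: split_beta)
    qed
    have "(\<Sum>(I, \<sigma>)\<in>signed_faces d. p * v I \<sigma> * measure (face_law d p I \<sigma>) ?A) =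
        p * (?c Lower * ?m Lower + ?c Middle * ?m Middle + ?c Upper * ?m Upper)"
      unfolding sum_distrib_left sum_distrib_right sum.distrib[symmetric]
    proof (intro sum.cong refl)
      fix F assume F: "F \<in> signed_faces d"
      obtain I \<sigma> where [simp]: "F = (I, \<sigma>)" by (cases F)
      have \<sigma>: "\<sigma> \<in> signs I" using F by (simp add: signed_faces_def)
      show "(case F of (I, \<sigma>) \<Rightarrow> p * v I \<sigma> * measure (face_law d p I \<sigma>) ?A) =
        p * ((case F of (I, \<sigma>) \<Rightarrow> if face_label d I \<sigma> i = Lower then v I \<sigma> else 0) * ?m Lower +
             (case F of (I, \<sigma>) \<Rightarrow> if face_label d I \<sigma> i = Middle then v I \<sigma> else 0) * ?m Middle +
             (case F of (I, \<sigma>) \<Rightarrow> if face_label d I \<sigma> i = Upper then v I \<sigma> else 0) * ?m Upper)"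
        by (cases "face_label d I \<sigma> i") (simp_all add: face[OF \<sigma>])
    qed
    moreover have "measure (face_law d p {} (\<lambda>_. undefined)) ?A = ?m Middle"
      using face[of "\<lambda>_. undefined" "{}"] i by (simp add: signs_def face_label_def)
    ultimately have "measure (witness_law d p v) ?A =
        p * ?m Lower + (1 - 2 * p) * ?m Middle + p * ?m Upper"
      using measure_witness_law[of ?A "\<lambda>_. undefined"] weight c[of Lower] c[of Upper]
      by (simp add: measurable_sets[OF mi A] algebra_simps)
    also have "\<dots> = measure unif01 A" by (rule unif01_mixture[OF p A])
    finally have "measure (witness_law d p v) ?A = measure unif01 A" .
    moreover interpret U: prob_space unif01 by (rule prob_space_unif01)
    have "space (witness_law d p v) = space (Pi\<^sub>M {1..d} (\<lambda>_. borel :: real measure))"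
      by (rule sets_eq_imp_space_eq[OF sets_witness_law])
    ultimately show "emeasure (distr (witness_law d p v) borel (\<lambda>x. x i)) A = emeasure unif01 A"
      by (simp add: emeasure_distr W.emeasure_eq_measure U.emeasure_eq_measure)
  qed simp
qed

end

section \<open>Realizations\<close>

lemma realizes_tri_inv:
  assumes "witness d p (tri_inv d lam)"
    and one: "\<forall>i\<in>{1..d}. lam {i} (\<lambda>j\<in>{i}. Lower) = 1 \<and> lam {i} (\<lambda>j\<in>{i}. Upper) = 1"
  shows "realizes d p lam (distribution_function d (witness_law d p (tri_inv d lam)))"
proof -
  interpret witness d p "tri_inv d lam" by fact
  have "({i}, \<lambda>j\<in>{i}. l) \<in> signed_faces d" if "i \<in> {1..d}" "l \<in> {Lower, Upper}" for i l
    using that by (auto simp: signed_faces_def signs_def)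
  then have "uniform_margins d (witness_law d p (tri_inv d lam))"
    using one by (intro uniform_margins_witness) (auto simp: coface_sum_tri_inv)
  then have "geometric_witness_copula d p (distribution_function d (witness_law d p (tri_inv d lam)))"
    unfolding geometric_witness_copula_def using p nonneg central_nonneg by blast
  then show ?thesis
    unfolding realizes_def by (auto simp: tail_family_witness coface_sum_tri_inv)
qed

text \<open>
  Whatever weights \<open>v\<close> witness the copula \<open>C\<close>, its tail family determines them, so they are those
  recovered from \<open>lam\<close>.
\<close>

lemma realizes_central_mass:
  assumes "realizes d p lam C"
  shows "cell_mass d p C (\<lambda>i\<in>{1..d}. Middle) = 1 - p * total_weight d (tri_inv d lam)"
proof -
  obtain v where v: "witness d p v" and C: "C = distribution_function d (witness_law d p v)"
    using assms unfolding realizes_def geometric_witness_copula_def witness_def by blast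
  interpret witness d p v by fact
  have "\<forall>(J, \<tau>)\<in>signed_faces d. coface_sum d v J \<tau> = lam J \<tau>"
    using assms by (auto simp: realizes_def C tail_family_witness)
  from tri_inv_unique[OF this] have "total_weight d v = total_weight d (tri_inv d lam)"
    unfolding total_weight_def by (intro sum.cong) auto
  then show ?thesis using cell_mass_central by (simp add: C)
qed

theorem corollary12:
  fixes d :: nat and lam :: signed_family and w :: signed_family and p :: "nat \<Rightarrow> real"
  assumes "d \<ge> 1"
    and "w = tri_inv d lam"
    and "\<forall>(I, \<sigma>)\<in>signed_faces d. w I \<sigma> \<ge> 0"
    and "\<forall>i\<in>{1..d}. lam {i} (\<lambda>j\<in>{i}. Lower) = 1 \<and> lam {i} (\<lambda>j\<in>{i}. Upper) = 1"
    and "\<forall>n\<ge>1. p n > 0"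
    and "\<forall>m\<ge>1. \<forall>n\<ge>m. p n \<le> p m"
    and "p \<longlonglongrightarrow> 0"
  shows "(\<forall>\<^sub>F n in sequentially. \<exists>C. realizes d (p n) lam C)
    \<and> (\<forall>n\<ge>1. \<forall>C. realizes d (p n) lam C \<longrightarrow>
          cell_mass d (p n) C (\<lambda>i\<in>{1..d}. Middle) = 1 - p n * total_weight d w)
    \<and> (\<lambda>n. 1 - p n * total_weight d w) \<longlonglongrightarrow> 1
    \<and> (\<forall>C. (\<forall>\<^sub>F n in sequentially. realizes d (p n) lam (C n)) \<longrightarrow>
          (\<lambda>n. cell_mass d (p n) (C n) (\<lambda>i\<in>{1..d}. Middle)) \<longlonglongrightarrow> 1)"
proof (intro conjI allI impI)
  have "(\<lambda>n. 1 - p n * total_weight d w) \<longlonglongrightarrow> 1 - 0 * total_weight d w"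
    by (intro tendsto_intros assms)
  then show lim: "(\<lambda>n. 1 - p n * total_weight d w) \<longlonglongrightarrow> 1" by simp
  have "\<forall>\<^sub>F n in sequentially. p n < 1 / 2"
    by (rule order_tendstoD[OF \<open>p \<longlonglongrightarrow> 0\<close>]) simp
  moreover have "\<forall>\<^sub>F n in sequentially. 0 < 1 - p n * total_weight d w"
    by (rule order_tendstoD[OF lim]) simp
  moreover have "\<forall>\<^sub>F n in sequentially. 1 \<le> n" by (rule eventually_ge_at_top)
  ultimately show "\<forall>\<^sub>F n in sequentially. \<exists>C. realizes d (p n) lam C"
  proof eventually_elim
    case (elim n)
    then have "witness d (p n) (tri_inv d lam)"
      using assms(2,3,5) by unfold_locales auto
    from realizes_tri_inv[OF this assms(4)] show ?case by blast
  qed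
  show central: "cell_mass d (p n) C (\<lambda>i\<in>{1..d}. Middle) = 1 - p n * total_weight d w"
    if "realizes d (p n) lam C" for n C
    using realizes_central_mass[OF that] assms(2) by simp
  show "(\<lambda>n. cell_mass d (p n) (C n) (\<lambda>i\<in>{1..d}. Middle)) \<longlonglongrightarrow> 1"
    if "\<forall>\<^sub>F n in sequentially. realizes d (p n) lam (C n)" for C
  proof (rule Lim_transform_eventually[OF lim])
    show "\<forall>\<^sub>F n in sequentially. 1 - p n * total_weight d w =
        cell_mass d (p n) (C n) (\<lambda>i\<in>{1..d}. Middle)"
      using that by eventually_elim (simp add: central)
  qed
qed

end
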